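(* Let $X$ and $Y$ be finite dimensional complex Hilbert spaces, let $\Gamma$ be a discrete abelian group, and let $\mathcal{G}=(G,\varphi,\theta,\tau)$ be a $\Gamma$-symmetric framework for $X$ and $Y$ with symbol function $\Phi=O_{\mathcal G}\in C(\hat\Gamma,B(X^{V_0},Y^{E_0}))$. Fix a gain graph for $(G,\theta)$ and let $\Gamma_0\subset\Gamma$ be the finite set of non-zero gains on the edges of this gain graph. (i) $\Phi$ is the operator-valued trigonometric polynomial with \[\Phi(\chi)=\hat\Phi(0)+\sum_{\gamma\in\Gamma_0}\hat\Phi(\gamma)\chi(\gamma),\quad\forall\,\chi\in\hat\Gamma.\] (ii) For each $\gamma\in\Gamma_0$, each $[v]\in V_0$ and each $[e]\in E_0$, \[\hat\Phi(\gamma)_{[e],[v]}=C(G,\varphi)_{\tilde e,\gamma\tilde v}\circ d\tau(\gamma),\] where $\hat\Phi(\gamma)_{[e],[v]}$ is the $([e],[v])$-entry of $\hat\Phi(\gamma)$ and $C(G,\varphi)_{\tilde e,\gamma\tilde v}$ is the $(\tilde e,\gamma\tilde v)$-entry of $C(G,\varphi)$.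
   Context: Frameworks. A framework for $X$ and $Y$ is a pair $(G,\varphi)$ with $G=(V,E)$ a simple undirected graph and $\varphi=(\varphi_{v,w})_{v,w\in V}$ a family of linear maps $\varphi_{v,w}:X\to Y$ with $\varphi_{v,w}=0$ if $vw\notin E$ and $\varphi_{v,w}=-\varphi_{w,v}$ if $vw\in E$. Throughout $V$ is finite or countably infinite. The coboundary matrix $C(G,\varphi)$ has rows indexed by $E$, columns indexed by $V$; in row $vw$ the $v$-entry is $\varphi_{v,w}$, the $w$-entry is $\varphi_{w,v}$, and other entries are $0$. Symmetry. $\Gamma$ is written additively with identity $0$. $\theta:\Gamma\to\mathrm{Aut}(G)$ is a homomorphism; write $\gamma v=\theta(\gamma)v$ and $\gamma e=(\gamma v)(\gamma w)$ for $e=vw$ (in particular $-\gamma v=\theta(-\gamma)v$). Standing assumptions: $\theta$ acts freely on vertices and edges ($\gamma v\ne v$, $\gamma e\neq e$ for all $\gamma\ne0$, $v\in V$, $e\in E$), and the sets $V_0$ of vertex orbits $[v]$ and $E_0$ of edge orbits $[e]$ are finite. $\tau:\Gamma\to\mathrm{Isom}(X)$ is a homomorphism into the group of affine isometries of $X$, with $d\tau(\gamma)$ the linear part of $\tau(\gamma)$. $(G,\varphi,\theta,\tau)$ is a $\Gamma$-symmetric framework if $\varphi_{\gamma v,\gamma w}=\varphi_{v,w}\circ d\tau(-\gamma)$ for all $\gamma\in\Gamma$, $v,w\in V$. Gain graph. Choose a representative $\tilde v\in[v]$ for each $[v]\in V_0$. The quotient multigraph has vertex set $V_0$ and edge set $E_0$,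 $[e]$ joining $[v]$ and $[w]$ if edges in $[e]$ join a vertex of $[v]$ to one of $[w]$; fix an orientation $[e]=([v],[w])$ of each edge. The gain of $[e]=([v],[w])$ is the $\gamma\in\Gamma$ with $\tilde v(\gamma\tilde w)\in[e]$ (for a loop, $[v]=[w]$, this determines $\gamma$ up to sign and one choice is fixed). Put $\tilde e=\tilde v(\gamma\tilde w)\in E$. Symbol function. $\hat\Gamma$ is the compact dual group with Haar probability measure. The symbol function of $\mathcal G$ is the continuous function $\Phi=O_{\mathcal G}:\hat\Gamma\to B(X^{V_0},Y^{E_0})$, where $O_{\mathcal G}(\chi)$ has the matrix with rows indexed by $E_0$ and columns by $V_0$ as follows. In the row of a non-loop directed edge $([v],[w])$ with gain $\gamma$: the $[v]$-entry is $\varphi_{\tilde v,\gamma\tilde w}$, the $[w]$-entry is $\chi(\gamma)\varphi_{\tilde w,-\gamma\tilde v}$, all others $0$. In the row of a loop $([v],[v])$ with gain $\gamma$: the $[v]$-entry is $\varphi_{\tilde v,\gamma\tilde v}+\chi(\gamma)\varphi_{\tilde v,-\gamma\tilde v}$, all others $0$. Fourier coefficients: $\hat\Phi(\gamma)=\int_{\hat\Gamma}\overline{\chi(\gamma)}\,\Phi(\chi)\,d\chi\in B(X^{V_0},Y^{E_0})$ for $\gamma\in\Gamma$. *)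

theory Defs
  imports "HOL-Analysis.Analysis" "HOL-Probability.Probability_Measure"
begin

section \<open>Complex Hilbert spaces\<close>

class complex_hilbert_space = banach +
  fixes scaleC :: "complex \<Rightarrow> 'a \<Rightarrow> 'a" (infixr "*\<^sub>C" 75)
    and cinner :: "'a \<Rightarrow> 'a \<Rightarrow> complex"
  assumes scaleR_scaleC: "r *\<^sub>R x = complex_of_real r *\<^sub>C x"
    and scaleC_add_right: "a *\<^sub>C (x + y) = a *\<^sub>C x + a *\<^sub>C y"
    and scaleC_add_left: "(a + b) *\<^sub>C x = a *\<^sub>C x + b *\<^sub>C x"
    and scaleC_scaleC: "a *\<^sub>C b *\<^sub>C x = (a * b) *\<^sub>C x"
    and scaleC_one: "1 *\<^sub>C x = x"
    and cinner_commute: "cinner x y = cnj (cinner y x)"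
    and cinner_add_right: "cinner x (y + z) = cinner x y + cinner x z"
    and cinner_scaleC_right: "cinner x (a *\<^sub>C y) = a * cinner x y"
    and cinner_self: "cinner x x = complex_of_real ((norm x)\<^sup>2)"

text \<open>Second countability is automatic in finite dimension; it is listed because the Bochner
  integral is only defined for types of that sort. The zero space is allowed.\<close>

class fin_dim_complex_hilbert_space = complex_hilbert_space + second_countable_topology +
  assumes finite_dim: "\<exists>B. finite B \<and> (\<forall>x. \<exists>c. x = (\<Sum>b\<in>B. c b *\<^sub>C b))"

instantiation complex :: fin_dim_complex_hilbert_space
begin

definition scaleC_complex :: "complex \<Rightarrow> complex \<Rightarrow> complex"
  where "scaleC_complex a x = a * x"

definition cinner_complex :: "complex \<Rightarrow> complex \<Rightarrow> complex"
  where "cinner_complex x y = cnj x * y"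

instance
proof
  show "\<exists>B :: complex set. finite B \<and> (\<forall>x. \<exists>c. x = (\<Sum>b\<in>B. c b *\<^sub>C b))"
    by (intro exI[of _ "{1}"]) (auto simp: scaleC_complex_def)
qed (simp_all add: scaleC_complex_def cinner_complex_def algebra_simps scaleR_conv_of_real
       complex_norm_square[symmetric] flip: of_real_power)

end

abbreviation clinear :: "('x::complex_hilbert_space \<Rightarrow> 'y::complex_hilbert_space) \<Rightarrow> bool"
  where "clinear \<equiv> Vector_Spaces.linear scaleC scaleC"

definition linear_part :: "('x::complex_hilbert_space \<Rightarrow> 'x) \<Rightarrow> 'x \<Rightarrow> 'x"
  where "linear_part f x = f x - f 0"

text \<open>Affine is meant over the complex numbers: the linear part of an affine isometry is unitary.\<close>

definition affine_isometry :: "('x::complex_hilbert_space \<Rightarrow> 'x) \<Rightarrow> bool"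
  where "affine_isometry f \<longleftrightarrow>
    bij f \<and> (\<forall>x y. dist (f x) (f y) = dist x y) \<and> clinear (linear_part f)"


section \<open>Frameworks\<close>

definition simple_graph :: "'v set \<Rightarrow> 'v set set \<Rightarrow> bool"
  where "simple_graph V E \<longleftrightarrow> (\<forall>e\<in>E. \<exists>v\<in>V. \<exists>w\<in>V. v \<noteq> w \<and> e = {v, w})"

definition framework ::
    "'v set \<Rightarrow> 'v set set
      \<Rightarrow> ('v \<Rightarrow> 'v \<Rightarrow> 'x::complex_hilbert_space \<Rightarrow> 'y::complex_hilbert_space) \<Rightarrow> bool"
  where "framework V E \<phi> \<longleftrightarrow>
    simple_graph V E \<and> countable V \<and>
    (\<forall>v\<in>V. \<forall>w\<in>V. clinear (\<phi> v w) \<and>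
      ({v, w} \<notin> E \<longrightarrow> \<phi> v w = (\<lambda>x. 0)) \<and>
      ({v, w} \<in> E \<longrightarrow> \<phi> v w = (\<lambda>x. - \<phi> w v x)))"

text \<open>The \<open>(e, u)\<close>-entry of the coboundary matrix; for \<open>u \<in> e\<close> the description
  operator picks the other endpoint of \<open>e\<close>.\<close>

definition coboundary ::
    "('v \<Rightarrow> 'v \<Rightarrow> 'x::complex_hilbert_space \<Rightarrow> 'y::complex_hilbert_space)
      \<Rightarrow> 'v set \<Rightarrow> 'v \<Rightarrow> 'x \<Rightarrow> 'y"
  where "coboundary \<phi> e u = (if u \<in> e then \<phi> u (THE w. e = {u, w}) else (\<lambda>x. 0))"


section \<open>Symmetry\<close>

definition graph_automorphism :: "'v set \<Rightarrow> 'v set set \<Rightarrow> ('v \<Rightarrow> 'v) \<Rightarrow> bool"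
  where "graph_automorphism V E f \<longleftrightarrow>
    bij_betw f V V \<and> (\<forall>v\<in>V. \<forall>w\<in>V. {f v, f w} \<in> E \<longleftrightarrow> {v, w} \<in> E)"

definition graph_action ::
    "'v set \<Rightarrow> 'v set set \<Rightarrow> ('g::ab_group_add \<Rightarrow> 'v \<Rightarrow> 'v) \<Rightarrow> bool"
  where "graph_action V E \<theta> \<longleftrightarrow>
    (\<forall>\<gamma>. graph_automorphism V E (\<theta> \<gamma>)) \<and>
    (\<forall>\<gamma> \<delta>. \<forall>v\<in>V. \<theta> (\<gamma> + \<delta>) v = \<theta> \<gamma> (\<theta> \<delta> v))"

definition free_action ::
    "'v set \<Rightarrow> 'v set set \<Rightarrow> ('g::ab_group_add \<Rightarrow> 'v \<Rightarrow> 'v) \<Rightarrow> bool"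
  where "free_action V E \<theta> \<longleftrightarrow>
    (\<forall>\<gamma>. \<gamma> \<noteq> 0 \<longrightarrow> (\<forall>v\<in>V. \<theta> \<gamma> v \<noteq> v) \<and> (\<forall>e\<in>E. \<theta> \<gamma> ` e \<noteq> e))"

definition vertex_orbits :: "'v set \<Rightarrow> ('g \<Rightarrow> 'v \<Rightarrow> 'v) \<Rightarrow> 'v set set"
  where "vertex_orbits V \<theta> = (\<lambda>v. range (\<lambda>\<gamma>. \<theta> \<gamma> v)) ` V"

definition edge_orbits :: "'v set set \<Rightarrow> ('g \<Rightarrow> 'v \<Rightarrow> 'v) \<Rightarrow> 'v set set set"
  where "edge_orbits E \<theta> = (\<lambda>e. range (\<lambda>\<gamma>. \<theta> \<gamma> ` e)) ` E"

definition isometric_action :: "('g::ab_group_add \<Rightarrow> 'x::complex_hilbert_space \<Rightarrow> 'x) \<Rightarrow> bool"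
  where "isometric_action \<tau> \<longleftrightarrow>
    (\<forall>\<gamma>. affine_isometry (\<tau> \<gamma>)) \<and> (\<forall>\<gamma> \<delta>. \<tau> (\<gamma> + \<delta>) = \<tau> \<gamma> \<circ> \<tau> \<delta>)"

definition symmetric_framework ::
    "'v set \<Rightarrow> 'v set set
      \<Rightarrow> ('v \<Rightarrow> 'v \<Rightarrow> 'x::complex_hilbert_space \<Rightarrow> 'y::complex_hilbert_space)
      \<Rightarrow> ('g::ab_group_add \<Rightarrow> 'v \<Rightarrow> 'v) \<Rightarrow> ('g \<Rightarrow> 'x \<Rightarrow> 'x) \<Rightarrow> bool"
  where "symmetric_framework V E \<phi> \<theta> \<tau> \<longleftrightarrow>
    framework V E \<phi> \<and>
    graph_action V E \<theta> \<and> free_action V E \<theta> \<and>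
    finite (vertex_orbits V \<theta>) \<and> finite (edge_orbits E \<theta>) \<and>
    isometric_action \<tau> \<and>
    (\<forall>\<gamma>. \<forall>v\<in>V. \<forall>w\<in>V. \<phi> (\<theta> \<gamma> v) (\<theta> \<gamma> w) = \<phi> v w \<circ> linear_part (\<tau> (- \<gamma>)))"


section \<open>Gain graphs\<close>

text \<open>The choices that determine a gain graph: representatives of the vertex orbits, and an
  orientation (\<open>source\<close>, \<open>target\<close>) and a gain for each edge orbit.\<close>

record ('v, 'g) gain_data =
  vrep :: "'v set \<Rightarrow> 'v"
  source :: "'v set set \<Rightarrow> 'v set"
  target :: "'v set set \<Rightarrow> 'v set"
  gain :: "'v set set \<Rightarrow> 'g"

definition edge_rep :: "('g \<Rightarrow> 'v \<Rightarrow> 'v) \<Rightarrow> ('v, 'g) gain_data \<Rightarrow> 'v set set \<Rightarrow> 'v set"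
  where "edge_rep \<theta> Q e = {vrep Q (source Q e), \<theta> (gain Q e) (vrep Q (target Q e))}"

text \<open>The condition \<open>edge_rep \<theta> Q e \<in> e\<close> says both that \<open>e\<close> joins its source and
  target and that \<open>gain Q e\<close> is a gain of \<open>e\<close>. It determines the gain of a non-loop from
  its orientation, and that of a loop up to sign.\<close>

definition gain_graph ::
    "'v set \<Rightarrow> 'v set set \<Rightarrow> ('g \<Rightarrow> 'v \<Rightarrow> 'v) \<Rightarrow> ('v, 'g) gain_data \<Rightarrow> bool"
  where "gain_graph V E \<theta> Q \<longleftrightarrow>
    (\<forall>v\<in>vertex_orbits V \<theta>. vrep Q v \<in> v) \<and>
    (\<forall>e\<in>edge_orbits E \<theta>. source Q e \<in> vertex_orbits V \<theta> \<and>
      target Q e \<in> vertex_orbits V \<theta> \<and> edge_rep \<theta> Q e \<in> e)"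

definition nonzero_gains ::
    "'v set set \<Rightarrow> ('g::zero \<Rightarrow> 'v \<Rightarrow> 'v) \<Rightarrow> ('v, 'g) gain_data \<Rightarrow> 'g set"
  where "nonzero_gains E \<theta> Q = gain Q ` edge_orbits E \<theta> - {0}"

lemma finite_nonzero_gains:
  assumes "symmetric_framework V E \<phi> \<theta> \<tau>"
  shows "finite (nonzero_gains E \<theta> Q)"
  using assms by (simp add: symmetric_framework_def nonzero_gains_def)


section \<open>The dual group\<close>

text \<open>The group is discrete, so every character is continuous and the compact-open topology on
  the dual is that of pointwise convergence, which is the topology of the function type.\<close>

definition dual_group :: "('g::ab_group_add \<Rightarrow> complex) set"
  where "dual_group = {\<xi>. (\<forall>\<gamma>. cmod (\<xi> \<gamma>) = 1) \<and> (\<forall>\<gamma> \<delta>. \<xi> (\<gamma> + \<delta>) = \<xi> \<gamma> * \<xi> \<delta>)}"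

text \<open>The last clause is inner regularity; it is part of the notion of Haar measure and can only
  fail for uncountable groups.\<close>

definition haar_probability :: "('g::ab_group_add \<Rightarrow> complex) measure \<Rightarrow> bool"
  where "haar_probability \<mu> \<longleftrightarrow>
    prob_space \<mu> \<and> space \<mu> = dual_group \<and> sets \<mu> = sets (restrict_space borel dual_group) \<and>
    (\<forall>\<psi>\<in>dual_group. \<forall>A\<in>sets \<mu>. emeasure \<mu> ((\<lambda>\<xi> \<gamma>. \<psi> \<gamma> * \<xi> \<gamma>) ` A) = emeasure \<mu> A) \<and>
    (\<forall>A\<in>sets \<mu>. emeasure \<mu> A = (SUP K\<in>{K. compact K \<and> K \<subseteq> A}. emeasure \<mu> K))"


section \<open>The symbol function\<close>

text \<open>For finite \<open>I\<close> and \<open>J\<close>, an operator from \<open>X\<^sup>I\<close> to \<open>Y\<^sup>J\<close> is represented as a function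
  \<open>('i \<Rightarrow> 'x) \<Rightarrow> ('j \<Rightarrow> 'y)\<close> that reads its argument on \<open>I\<close> only and whose values vanish
  outside \<open>J\<close>.\<close>

definition block_operator ::
    "'i set \<Rightarrow> 'j set \<Rightarrow> ('j \<Rightarrow> 'i \<Rightarrow> 'x \<Rightarrow> 'y) \<Rightarrow> ('i \<Rightarrow> 'x) \<Rightarrow> 'j \<Rightarrow> 'y::comm_monoid_add"
  where "block_operator I J M u = (\<lambda>j. if j \<in> J then \<Sum>i\<in>I. M j i (u i) else 0)"

definition operator_entry ::
    "(('i \<Rightarrow> 'x::zero) \<Rightarrow> 'j \<Rightarrow> 'y) \<Rightarrow> 'j \<Rightarrow> 'i \<Rightarrow> 'x \<Rightarrow> 'y"
  where "operator_entry T j i x = T (\<lambda>k. if k = i then x else 0) j"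

definition symbol_entry ::
    "('v \<Rightarrow> 'v \<Rightarrow> 'x::complex_hilbert_space \<Rightarrow> 'y::complex_hilbert_space)
      \<Rightarrow> ('g::ab_group_add \<Rightarrow> 'v \<Rightarrow> 'v) \<Rightarrow> ('v, 'g) gain_data
      \<Rightarrow> ('g \<Rightarrow> complex) \<Rightarrow> 'v set set \<Rightarrow> 'v set \<Rightarrow> 'x \<Rightarrow> 'y"
  where "symbol_entry \<phi> \<theta> Q \<xi> e u =
    (let v = source Q e; w = target Q e; \<gamma> = gain Q e; v' = vrep Q v; w' = vrep Q w in
     if v \<noteq> w then
       if u = v then \<phi> v' (\<theta> \<gamma> w')
       else if u = w then (\<lambda>x. \<xi> \<gamma> *\<^sub>C \<phi> w' (\<theta> (- \<gamma>) v') x)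
       else (\<lambda>x. 0)
     else
       if u = v then (\<lambda>x. \<phi> v' (\<theta> \<gamma> v') x + \<xi> \<gamma> *\<^sub>C \<phi> v' (\<theta> (- \<gamma>) v') x)
       else (\<lambda>x. 0))"

definition symbol ::
    "'v set \<Rightarrow> 'v set set
      \<Rightarrow> ('v \<Rightarrow> 'v \<Rightarrow> 'x::complex_hilbert_space \<Rightarrow> 'y::complex_hilbert_space)
      \<Rightarrow> ('g::ab_group_add \<Rightarrow> 'v \<Rightarrow> 'v) \<Rightarrow> ('v, 'g) gain_data
      \<Rightarrow> ('g \<Rightarrow> complex) \<Rightarrow> ('v set \<Rightarrow> 'x) \<Rightarrow> 'v set set \<Rightarrow> 'y"
  where "symbol V E \<phi> \<theta> Q \<xi> =
    block_operator (vertex_orbits V \<theta>) (edge_orbits E \<theta>) (symbol_entry \<phi> \<theta> Q \<xi>)"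

text \<open>The integral of an operator-valued function is taken pointwise, as a Bochner integral in
  \<open>Y\<close> for each argument and each coordinate. For continuous functions into the operators between
  two finite-dimensional spaces this is the integral in operator norm, because evaluations are
  bounded linear functionals that separate operators.\<close>

definition fourier_coeff ::
    "('g \<Rightarrow> complex) measure
      \<Rightarrow> (('g \<Rightarrow> complex) \<Rightarrow> ('i \<Rightarrow> 'x) \<Rightarrow> 'j \<Rightarrow> 'y::fin_dim_complex_hilbert_space)
      \<Rightarrow> 'g \<Rightarrow> ('i \<Rightarrow> 'x) \<Rightarrow> 'j \<Rightarrow> 'y"
  where "fourier_coeff \<mu> \<Phi> \<gamma> u j = (\<integral>\<xi>. cnj (\<xi> \<gamma>) *\<^sub>C \<Phi> \<xi> u j \<partial>\<mu>)"

lemma norm_scaleC: "norm (c *\<^sub>C x) = cmod c * norm x"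
  for x :: "'x::complex_hilbert_space"
proof -
  have "cinner (c *\<^sub>C x) x = cnj c * cinner x x"
    by (metis cinner_commute cinner_scaleC_right complex_cnj_mult)
  then have "complex_of_real ((norm (c *\<^sub>C x))\<^sup>2) = (c * cnj c) * complex_of_real ((norm x)\<^sup>2)"
    by (simp only: cinner_scaleC_right mult.assoc flip: cinner_self)
  also have "\<dots> = complex_of_real ((cmod c * norm x)\<^sup>2)"
    by (simp add: power_mult_distrib flip: complex_norm_square)
  finally have "complex_of_real ((norm (c *\<^sub>C x))\<^sup>2) = complex_of_real ((cmod c * norm x)\<^sup>2)" .
  then show ?thesis
    by (simp only: of_real_eq_iff) (simp add: power2_eq_iff_nonneg)
qed

lemma continuous_on_symbol:
  fixes \<phi> :: "'v \<Rightarrow> 'v \<Rightarrow> 'x::complex_hilbert_space \<Rightarrow> 'y::complex_hilbert_space"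
  shows "continuous_on dual_group (\<lambda>\<xi>. symbol V E \<phi> \<theta> Q \<xi> u e)"
proof -
  have "bounded_linear (\<lambda>c. c *\<^sub>C y)" for y :: 'y
    by (rule bounded_linear_intro[of _ "norm y"])
      (simp_all add: scaleC_add_left scaleR_scaleC scaleC_scaleC scaleC_complex_def norm_scaleC)
  then have *: "continuous_on dual_group (\<lambda>\<xi>. \<xi> \<gamma> *\<^sub>C y)" for y :: 'y and \<gamma> :: 'a
    by (rule bounded_linear.continuous_on)
      (rule continuous_on_subset[OF continuous_on_product_coordinates subset_UNIV])
  have "continuous_on dual_group (\<lambda>\<xi>. symbol_entry \<phi> \<theta> Q \<xi> e v x)" for v x
    by (cases "source Q e = target Q e"; cases "v = source Q e"; cases "v = target Q e")
      (simp_all add: symbol_entry_def Let_def * continuous_intros)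
  then show ?thesis
    by (cases "e \<in> edge_orbits E \<theta>")
      (simp_all add: symbol_def block_operator_def continuous_intros)
qed

end

theory Submission
  imports Defs
begin

text \<open>
  In each row \<open>e\<close>, with source \<open>s\<close>, target \<open>t\<close> and gain \<open>\<gamma>\<close>, the symbol function has the form
  \<open>\<Phi>(\<xi>) u = \<phi>\<^bsub>s',\<gamma>t'\<^esub> u\<^sub>s + \<xi>(\<gamma>) \<phi>\<^bsub>t',-\<gamma>s'\<^esub> u\<^sub>t\<close>, whether or not \<open>e\<close> is a loop
  (\<open>symbol_row\<close>). So it is a trigonometric polynomial with frequencies \<open>0\<close> and \<open>\<gamma>\<close>, and the
  orthogonality of the characters of the dual group (\<open>integral_dual_coordinate\<close>) reads off its
  Fourier coefficients: a non-zero \<open>\<gamma>\<close> picks out the second summand in the rows of gain \<open>\<gamma>\<close>.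
  This gives the expansion. For the matrix entries, freeness of the action on vertices shows that, if \<open>\<gamma> \<noteq> 0\<close>,
  \<open>\<gamma>v'\<close> is an endpoint of the chosen edge of the orbit \<open>e\<close> exactly if \<open>v = t\<close> and \<open>e\<close> has gain
  \<open>\<gamma>\<close> (\<open>translate_in_edge_rep_iff\<close>), and then equivariance of \<open>\<phi>\<close> moves the pair
  \<open>(t', -\<gamma>s')\<close> to \<open>(\<gamma>t', s')\<close> at the cost of the factor \<open>d\<tau>(\<gamma>)\<close>.

  Orthogonality follows from the invariance of Haar measure as soon as for every \<open>\<gamma> \<noteq> 0\<close> some
  character takes a value other than \<open>1\<close> at \<open>\<gamma>\<close> (\<open>dual_group_separates_points\<close>). This is where
  the group enters in full generality: characters of subgroups extend because the circle is
  divisible, one generator at a time, and Zorn's lemma does the rest.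
\<close>

section \<open>Characters separate points\<close>

text \<open>A character of a subgroup is encoded by its graph, a subgroup of the product of the group and
  the circle that meets the second factor trivially. In this form unions of chains are immediate.\<close>

definition partial_character :: "('g::ab_group_add \<times> complex) set \<Rightarrow> bool"
  where "partial_character R \<longleftrightarrow>
    (0, 1) \<in> R \<and> (\<forall>x z. (x, z) \<in> R \<longrightarrow> cmod z = 1) \<and>
    (\<forall>x z y w. (x, z) \<in> R \<longrightarrow> (y, w) \<in> R \<longrightarrow> (x - y, z / w) \<in> R) \<and>
    (\<forall>z. (0, z) \<in> R \<longrightarrow> z = 1)"

definition nat_multiple :: "nat \<Rightarrow> 'g::ab_group_add \<Rightarrow> 'g"
  where "nat_multiple n x = (\<Sum>i<n. x)"

lemma nat_multiple_simps [simp]: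
  "nat_multiple 0 x = 0" "nat_multiple (Suc n) x = x + nat_multiple n x"
  by (simp_all add: nat_multiple_def add.commute)

lemma nat_multiple_add: "nat_multiple (m + n) x = nat_multiple m x + nat_multiple n x"
  by (induction m) (simp_all add: add.assoc)

lemma nat_multiple_mult: "nat_multiple (m * n) x = nat_multiple m (nat_multiple n x)"
  by (induction m) (simp_all add: nat_multiple_add)

lemma partial_characterD:
  assumes "partial_character R"
  shows "(0, 1) \<in> R"
    and "(x, z) \<in> R \<Longrightarrow> cmod z = 1"
    and "(x, z) \<in> R \<Longrightarrow> (y, w) \<in> R \<Longrightarrow> (x - y, z / w) \<in> R"
    and "(0, z) \<in> R \<Longrightarrow> z = 1"
  using assms unfolding partial_character_def by blast+

lemma partial_character_nonzero:
  assumes "partial_character R" "(x, z) \<in> R"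
  shows "z \<noteq> 0"
  using partial_characterD(2)[OF assms] by auto

lemma partial_character_add:
  assumes R: "partial_character R" and "(x, z) \<in> R" "(y, w) \<in> R"
  shows "(x + y, z * w) \<in> R"
proof -
  have "(0 - y, 1 / w) \<in> R"
    using partial_characterD(1,3)[OF R] assms by blast
  from partial_characterD(3)[OF R assms(2) this] show ?thesis
    by simp
qed

lemma partial_character_functional:
  assumes R: "partial_character R" and "(x, z) \<in> R" "(x, w) \<in> R"
  shows "z = w"
proof -
  have "(0, z / w) \<in> R"
    using partial_characterD(3)[OF assms] by simp
  then have "z / w = 1"
    by (rule partial_characterD(4)[OF R])
  then show ?thesis
    by (auto simp: divide_eq_1_iff)
qed

lemma partial_character_nat_multiple:
  assumes "partial_character R" "(x, z) \<in> R"
  shows "(nat_multiple n x, z ^ n) \<in> R"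
  by (induction n) (simp_all add: partial_characterD(1)[OF assms(1)] partial_character_add assms)

text \<open>The value \<open>w\<close> at a new element \<open>x\<close> is subject only to the values already prescribed
  at the multiples of \<open>x\<close>.\<close>

lemma partial_character_adjoin:
  fixes x :: "'g::ab_group_add"
  assumes R: "partial_character R" and w: "cmod w = 1"
    and compatible: "\<And>n z. (nat_multiple n x, z) \<in> R \<Longrightarrow> z = w ^ n"
  shows "\<exists>R'. partial_character R' \<and> R \<subseteq> R' \<and> (x, w) \<in> R'"
proof -
  note RD = partial_characterD[OF R]
  have w0: "w \<noteq> 0"
    using w by auto
  \<comment> \<open>Integer multiples of \<open>x\<close> are written as differences of natural multiples.\<close>
  define R' where
    "R' = {(y + nat_multiple n x - nat_multiple m x, z * w ^ n / w ^ m) | y z n m. (y, z) \<in> R}"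
  have mem: "(y + nat_multiple n x - nat_multiple m x, z * w ^ n / w ^ m) \<in> R'"
    if "(y, z) \<in> R" for y z n m
    using that unfolding R'_def by blast
  have trivial: "z * w ^ n / w ^ m = 1"
    if yz: "(y, z) \<in> R" and eq: "y + nat_multiple n x - nat_multiple m x = 0" for y z n m
  proof (cases "n \<le> m")
    case True
    then obtain k where k: "m = n + k"
      by (auto simp: le_iff_add)
    have "y = nat_multiple k x"
      using eq by (simp add: k nat_multiple_add algebra_simps)
    then have "z = w ^ k"
      using yz compatible by blast
    then show ?thesis
      using w0 by (simp add: k power_add)
  next
    case False
    then obtain k where k: "n = m + k"
      by (metis le_iff_add nat_le_linear)
    have "0 - y = nat_multiple k x"
      using eq by (simp add: k nat_multiple_add algebra_simps neg_eq_iff_add_eq_0)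
    moreover have "(0 - y, 1 / z) \<in> R"
      using RD(3)[OF RD(1) yz] .
    ultimately have "1 / z = w ^ k"
      using compatible by metis
    then show ?thesis
      using w0 partial_character_nonzero[OF R yz] by (simp add: k power_add field_simps)
  qed
  have "p = 1" if "(0, p) \<in> R'" for p
  proof -
    from that obtain z n m y
      where "(y, z) \<in> R" "y + nat_multiple n x - nat_multiple m x = 0" "p = z * w ^ n / w ^ m"
      unfolding R'_def by auto
    then show ?thesis
      using trivial by blast
  qed
  moreover have "(a - b, p / q) \<in> R'" if "(a, p) \<in> R'" "(b, q) \<in> R'" for a b p q
  proof -
    obtain y z n m where 1: "a = y + nat_multiple n x - nat_multiple m x"
        "p = z * w ^ n / w ^ m" "(y, z) \<in> R"
      using \<open>(a, p) \<in> R'\<close> unfolding R'_def by blast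
    obtain y' z' n' m' where 2: "b = y' + nat_multiple n' x - nat_multiple m' x"
        "q = z' * w ^ n' / w ^ m'" "(y', z') \<in> R"
      using \<open>(b, q) \<in> R'\<close> unfolding R'_def by blast
    have "a - b = (y - y') + nat_multiple (n + m') x - nat_multiple (m + n') x"
      by (simp add: 1 2 nat_multiple_add algebra_simps)
    moreover have "p / q = (z / z') * w ^ (n + m') / w ^ (m + n')"
      using w0 partial_character_nonzero[OF R 2(3)] by (simp add: 1 2 power_add field_simps)
    ultimately show ?thesis
      using mem[OF RD(3)[OF 1(3) 2(3)], of "n + m'" "m + n'"] by simp
  qed
  moreover have "(0, 1) \<in> R'" "(x, w) \<in> R'"
    using mem[OF RD(1), of 0 0] mem[OF RD(1), of 1 0] by simp_all
  moreover have "R \<subseteq> R'"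
  proof
    fix p assume "p \<in> R"
    then show "p \<in> R'"
      using mem[of "fst p" "snd p" 0 0] by simp
  qed
  moreover have "cmod p = 1" if "(a, p) \<in> R'" for a p
  proof -
    from that obtain z n m y where "(y, z) \<in> R" "p = z * w ^ n / w ^ m"
      unfolding R'_def by blast
    then show ?thesis
      using w RD(2) by (simp add: norm_mult norm_divide norm_power)
  qed
  ultimately have "partial_character R'"
    unfolding partial_character_def by blast
  with \<open>R \<subseteq> R'\<close> \<open>(x, w) \<in> R'\<close> show ?thesis
    by blast
qed

text \<open>Divisibility of the circle, with the extra information that for \<open>d \<ge> 2\<close> there is more
  than one root.\<close>

lemma unimodular_root_neq_1:
  assumes "cmod z = 1" "2 \<le> d"
  shows "\<exists>w. cmod w = 1 \<and> w \<noteq> 1 \<and> w ^ d = z"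
proof (cases "z = 1")
  case True
  have "0 < 2 * pi / d" "2 * pi / d \<le> pi"
    using assms(2) by (simp_all add: field_simps)
  then have "cos (2 * pi / d) < cos 0"
    by (intro cos_monotone_0_pi) auto
  then have "cis (2 * pi / d) \<noteq> 1"
    by (metis cis.sel(1) cos_zero less_irrefl one_complex.sel(1))
  moreover have "cis (2 * pi / d) ^ d = z"
    using assms(2) True by (subst Complex.DeMoivre) simp
  ultimately show ?thesis
    by (intro exI[of _ "cis (2 * pi / d)"]) simp
next
  case False
  have "cis (Arg z / d) ^ d = z"
    using assms by (simp add: Complex.DeMoivre cis_Arg sgn_div_norm)
      (metis cis_Arg assms(1) div_by_1 norm_zero of_real_1 sgn_eq zero_neq_one)
  then show ?thesis
    using False by (intro exI[of _ "cis (Arg z / d)"]) auto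
qed

text \<open>Extension by one element. The value differs from \<open>1\<close>; applied to the trivial
  subgroup this produces a character that is non-trivial at a given element.\<close>

lemma partial_character_extend:
  fixes x :: "'g::ab_group_add"
  assumes R: "partial_character R" and x: "x \<notin> Domain R"
  shows "\<exists>R' w. partial_character R' \<and> R \<subseteq> R' \<and> (x, w) \<in> R' \<and> w \<noteq> 1"
proof -
  have "\<exists>w. cmod w = 1 \<and> w \<noteq> 1 \<and> (\<forall>n z. (nat_multiple n x, z) \<in> R \<longrightarrow> z = w ^ n)"
  proof (cases "\<exists>d>0. nat_multiple d x \<in> Domain R")
    case True
    \<comment> \<open>The least such \<open>d\<close> is the order of \<open>x\<close> modulo the domain.\<close>
    define d where "d = (LEAST d. 0 < d \<and> nat_multiple d x \<in> Domain R)"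
    have d: "0 < d" "nat_multiple d x \<in> Domain R"
      using LeastI_ex[of "\<lambda>d. 0 < d \<and> nat_multiple d x \<in> Domain R"] True unfolding d_def by auto
    then obtain z0 where z0: "(nat_multiple d x, z0) \<in> R"
      by blast
    have "d \<noteq> 1"
      using d(2) x by auto
    then obtain w where w: "cmod w = 1" "w \<noteq> 1" "w ^ d = z0"
      using unimodular_root_neq_1[of z0 d] partial_characterD(2)[OF R z0] d(1) by auto
    have "z = w ^ n" if n: "(nat_multiple n x, z) \<in> R" for n z
    proof -
      define q r where "q = n div d" and "r = n mod d"
      have nqr: "n = q * d + r"
        by (simp add: q_def r_def)
      have q: "(nat_multiple (q * d) x, z0 ^ q) \<in> R"
        using partial_character_nat_multiple[OF R z0] by (simp add: nat_multiple_mult)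
      have "(nat_multiple r x, z / z0 ^ q) \<in> R"
        using partial_characterD(3)[OF R n q] by (simp add: nqr nat_multiple_add)
      moreover have "r < d"
        using d(1) by (simp add: r_def)
      ultimately have "r = 0"
        using not_less_Least[of r "\<lambda>d. 0 < d \<and> nat_multiple d x \<in> Domain R"]
        unfolding d_def[symmetric] by (metis Domain.DomainI gr0I)
      then have "z = z0 ^ q"
        using partial_character_functional[OF R n] q nqr by simp
      then show ?thesis
        using \<open>r = 0\<close> by (simp add: nqr mult.commute[of q] power_mult w(3))
    qed
    with w show ?thesis
      by blast
  next
    case False
    have "z = (-1) ^ n" if "(nat_multiple n x, z) \<in> R" for n z
    proof -
      have "n = 0"
        using False that by (metis Domain.DomainI gr0I)
      with that show ?thesis
        using partial_characterD(4)[OF R] by simp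
    qed
    then show ?thesis
      by (intro exI[of _ "-1"]) simp
  qed
  then obtain w where "cmod w = 1" "w \<noteq> 1" "\<And>n z. (nat_multiple n x, z) \<in> R \<Longrightarrow> z = w ^ n"
    by blast
  then show ?thesis
    using partial_character_adjoin[OF R, of w x] by blast
qed

lemma partial_character_Union:
  assumes "\<C> \<noteq> {}" and chain: "subset.chain (Collect partial_character) \<C>"
  shows "partial_character (\<Union>\<C>)"
proof -
  have pc: "partial_character R" if "R \<in> \<C>" for R
    using that chain by (auto simp: subset.chain_def)
  have "(x - y, z / w) \<in> \<Union>\<C>" if xz: "(x, z) \<in> \<Union>\<C>" and yw: "(y, w) \<in> \<Union>\<C>" for x y z w
  proof -
    obtain R S where "R \<in> \<C>" "(x, z) \<in> R" "S \<in> \<C>" "(y, w) \<in> S"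
      using xz yw by blast
    moreover have "R \<subseteq> S \<or> S \<subseteq> R"
      using chain \<open>R \<in> \<C>\<close> \<open>S \<in> \<C>\<close> by (auto simp: subset_chain_def)
    ultimately obtain T where "T \<in> \<C>" "(x, z) \<in> T" "(y, w) \<in> T"
      by blast
    then show ?thesis
      using partial_characterD(3)[OF pc] by blast
  qed
  moreover have "(0, 1) \<in> \<Union>\<C>"
    using assms(1) partial_characterD(1)[OF pc] by blast
  ultimately show ?thesis
    using partial_characterD(2)[OF pc] partial_characterD(4)[OF pc]
    unfolding partial_character_def by blast
qed

lemma total_partial_character_in_dual_group:
  assumes R: "partial_character R" and total: "Domain R = UNIV"
  shows "\<exists>\<xi>\<in>dual_group. \<forall>x z. (x, z) \<in> R \<longrightarrow> \<xi> x = z"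
proof -
  have "\<forall>x. \<exists>z. (x, z) \<in> R"
    using total by blast
  then obtain \<xi> where \<xi>: "\<And>x. (x, \<xi> x) \<in> R"
    by metis
  have "\<xi> (x + y) = \<xi> x * \<xi> y" for x y
    using partial_character_functional[OF R \<xi>] partial_character_add[OF R \<xi> \<xi>] by blast
  then have "\<xi> \<in> dual_group"
    using partial_characterD(2)[OF R \<xi>] by (simp add: dual_group_def)
  then show ?thesis
    using partial_character_functional[OF R \<xi>] by blast
qed

lemma dual_group_separates_points:
  fixes a :: "'g::ab_group_add"
  assumes "a \<noteq> 0"
  shows "\<exists>\<xi>\<in>dual_group. \<xi> a \<noteq> 1"
proof -
  have "partial_character {(0 :: 'g, 1)}"
    by (simp add: partial_character_def)
  moreover have "a \<notin> Domain {(0 :: 'g, 1 :: complex)}"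
    using assms by simp
  ultimately obtain R0 c where R0: "partial_character R0" and c: "(a, c) \<in> R0" "c \<noteq> 1"
    using partial_character_extend by blast
  let ?A = "{R. partial_character R \<and> R0 \<subseteq> R}"
  have "\<exists>M\<in>?A. \<forall>R\<in>?A. M \<subseteq> R \<longrightarrow> R = M"
  proof (rule subset_Zorn_nonempty)
    show "?A \<noteq> {}"
      using R0 by blast
  next
    fix \<C> assume ne: "\<C> \<noteq> {}" and chain: "subset.chain ?A \<C>"
    then have "subset.chain (Collect partial_character) \<C>"
      by (auto simp: subset_chain_def)
    then have "partial_character (\<Union>\<C>)"
      by (rule partial_character_Union[OF ne])
    moreover have "R0 \<subseteq> \<Union>\<C>"
      using ne chain unfolding subset_chain_def by blast
    ultimately show "\<Union>\<C> \<in> ?A"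
      by blast
  qed
  then obtain M where "M \<in> ?A" and maximal: "\<forall>R\<in>?A. M \<subseteq> R \<longrightarrow> R = M"
    by (rule bexE)
  then have M: "partial_character M" "R0 \<subseteq> M"
    by simp_all
  have max: "R = M" if "partial_character R" "M \<subseteq> R" for R
    using maximal M(2) that by simp
  have "x \<in> Domain M" for x
    using partial_character_extend[OF M(1), of x] max by blast
  then obtain \<xi> where "\<xi> \<in> dual_group" "\<forall>x z. (x, z) \<in> M \<longrightarrow> \<xi> x = z"
    using total_partial_character_in_dual_group[OF M(1)] by blast
  with c M(2) show ?thesis
    by blast
qed

section \<open>Orthogonality of characters\<close>

lemma dual_group_add: "\<xi> \<in> dual_group \<Longrightarrow> \<xi> (\<gamma> + \<delta>) = \<xi> \<gamma> * \<xi> \<delta>"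
  and dual_group_norm: "\<xi> \<in> dual_group \<Longrightarrow> cmod (\<xi> \<gamma>) = 1"
  by (simp_all add: dual_group_def)

lemma dual_group_0:
  assumes "\<xi> \<in> dual_group"
  shows "\<xi> 0 = 1"
  using dual_group_add[OF assms, of 0 0] dual_group_norm[OF assms, of 0] by auto

lemma dual_group_minus:
  assumes "\<xi> \<in> dual_group"
  shows "\<xi> (- \<gamma>) = cnj (\<xi> \<gamma>)"
proof -
  have "\<xi> (- \<gamma>) * \<xi> \<gamma> = 1"
    using dual_group_add[OF assms, of "- \<gamma>" \<gamma>] dual_group_0[OF assms] by simp
  moreover have "cnj (\<xi> \<gamma>) * \<xi> \<gamma> = 1"
    using dual_group_norm[OF assms, of \<gamma>] complex_norm_square[of "\<xi> \<gamma>"] by (simp add: mult.commute)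
  ultimately show ?thesis
    by (metis mult_right_cancel mult_zero_right zero_neq_one)
qed

lemma dual_group_mult:
  "\<psi> \<in> dual_group \<Longrightarrow> \<xi> \<in> dual_group \<Longrightarrow> (\<lambda>\<gamma>. \<psi> \<gamma> * \<xi> \<gamma>) \<in> dual_group"
  by (simp add: dual_group_def norm_mult mult_ac)

lemma dual_group_cnj: "\<psi> \<in> dual_group \<Longrightarrow> (\<lambda>\<gamma>. cnj (\<psi> \<gamma>)) \<in> dual_group"
  by (simp add: dual_group_def)

context
  fixes \<mu> :: "('g::ab_group_add \<Rightarrow> complex) measure"
  assumes haar: "haar_probability \<mu>"
begin

lemma space_haar: "space \<mu> = dual_group"
  and sets_haar: "sets \<mu> = sets (restrict_space borel dual_group)"
  and prob_space_haar: "prob_space \<mu>"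
  using haar by (simp_all add: haar_probability_def)

lemma measurable_haar_coordinate: "(\<lambda>\<xi>. \<xi> \<gamma>) \<in> borel_measurable \<mu>"
  unfolding measurable_cong_sets[OF sets_haar refl]
  by (intro measurable_restrict_space1 borel_measurable_continuous_onI
      continuous_on_product_coordinates)

lemma integrable_haar_coordinate: "integrable \<mu> (\<lambda>\<xi>. \<xi> \<gamma>)"
proof -
  interpret prob_space \<mu>
    by (rule prob_space_haar)
  show ?thesis
    by (rule integrable_const_bound[of _ 1])
      (auto intro!: AE_I2 simp: space_haar dual_group_norm measurable_haar_coordinate)
qed

lemma measurable_haar_translation:
  assumes "\<psi> \<in> dual_group"
  shows "(\<lambda>\<xi> \<gamma>. \<psi> \<gamma> * \<xi> \<gamma>) \<in> measurable \<mu> \<mu>"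
  unfolding measurable_cong_sets[OF sets_haar sets_haar]
  by (intro measurable_restrict_space3 borel_measurable_continuous_onI
      continuous_on_coordinatewise_then_product continuous_intros continuous_on_product_coordinates)
    (auto intro: dual_group_mult[OF assms])

text \<open>Invariance is stated for images of sets; the image under a translation is the preimage under
  the translation by the inverse, that is, the conjugate character.\<close>

lemma distr_haar_translation:
  assumes \<psi>: "\<psi> \<in> dual_group"
  shows "distr \<mu> \<mu> (\<lambda>\<xi> \<gamma>. \<psi> \<gamma> * \<xi> \<gamma>) = \<mu>"
proof (rule measure_eqI)
  fix A assume "A \<in> sets (distr \<mu> \<mu> (\<lambda>\<xi> \<gamma>. \<psi> \<gamma> * \<xi> \<gamma>))"
  then have A: "A \<in> sets \<mu>"
    by simp
  have inv: "\<psi> \<gamma> * cnj (\<psi> \<gamma>) = 1" for \<gamma>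
    using dual_group_norm[OF \<psi>, of \<gamma>] complex_norm_square[of "\<psi> \<gamma>"] by simp
  have inv': "\<psi> \<gamma> * (cnj (\<psi> \<gamma>) * z) = z" "cnj (\<psi> \<gamma>) * (\<psi> \<gamma> * z) = z" for \<gamma> z
    using inv[of \<gamma>] by (metis mult.assoc mult.commute mult_1)+
  have A_sub: "A \<subseteq> dual_group"
    using sets.sets_into_space[OF A] by (simp add: space_haar)
  have "(\<lambda>\<xi> \<gamma>. \<psi> \<gamma> * \<xi> \<gamma>) -` A \<inter> space \<mu> = (\<lambda>\<xi> \<gamma>. cnj (\<psi> \<gamma>) * \<xi> \<gamma>) ` A"
  proof (intro equalityI subsetI)
    fix \<xi> assume "\<xi> \<in> (\<lambda>\<xi> \<gamma>. \<psi> \<gamma> * \<xi> \<gamma>) -` A \<inter> space \<mu>"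
    then show "\<xi> \<in> (\<lambda>\<xi> \<gamma>. cnj (\<psi> \<gamma>) * \<xi> \<gamma>) ` A"
      by (intro image_eqI[of _ _ "\<lambda>\<gamma>. \<psi> \<gamma> * \<xi> \<gamma>"]) (auto simp: inv')
  next
    fix \<xi> assume "\<xi> \<in> (\<lambda>\<xi> \<gamma>. cnj (\<psi> \<gamma>) * \<xi> \<gamma>) ` A"
    then show "\<xi> \<in> (\<lambda>\<xi> \<gamma>. \<psi> \<gamma> * \<xi> \<gamma>) -` A \<inter> space \<mu>"
      using A_sub dual_group_mult[OF dual_group_cnj[OF \<psi>]] by (auto simp: space_haar inv')
  qed
  then show "emeasure (distr \<mu> \<mu> (\<lambda>\<xi> \<gamma>. \<psi> \<gamma> * \<xi> \<gamma>)) A = emeasure \<mu> A"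
    using haar dual_group_cnj[OF \<psi>] A
    by (simp add: emeasure_distr[OF measurable_haar_translation[OF \<psi>] A] haar_probability_def)
qed simp

text \<open>Translation by a character \<open>\<psi>\<close> multiplies the integral by \<open>\<psi> \<gamma>\<close>, which can be chosen
  different from \<open>1\<close> if \<open>\<gamma> \<noteq> 0\<close>.\<close>

lemma integral_dual_coordinate: "(\<integral>\<xi>. \<xi> \<gamma> \<partial>\<mu>) = (if \<gamma> = 0 then 1 else 0)"
proof (cases "\<gamma> = 0")
  case True
  interpret prob_space \<mu>
    by (rule prob_space_haar)
  have "(\<integral>\<xi>. \<xi> \<gamma> \<partial>\<mu>) = (\<integral>\<xi>. 1 \<partial>\<mu>)"
    by (rule Bochner_Integration.integral_cong) (simp_all add: True space_haar dual_group_0)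
  then show ?thesis
    using True by (simp add: prob_space)
next
  case False
  then obtain \<psi> where \<psi>: "\<psi> \<in> dual_group" "\<psi> \<gamma> \<noteq> 1"
    using dual_group_separates_points by blast
  have "(\<integral>\<xi>. \<xi> \<gamma> \<partial>\<mu>) = (\<integral>\<xi>. \<xi> \<gamma> \<partial>distr \<mu> \<mu> (\<lambda>\<xi> \<gamma>. \<psi> \<gamma> * \<xi> \<gamma>))"
    by (simp only: distr_haar_translation[OF \<psi>(1)])
  also have "\<dots> = (\<integral>\<xi>. \<psi> \<gamma> * \<xi> \<gamma> \<partial>\<mu>)"
    by (rule integral_distr[OF measurable_haar_translation[OF \<psi>(1)] measurable_haar_coordinate])
  also have "\<dots> = \<psi> \<gamma> * (\<integral>\<xi>. \<xi> \<gamma> \<partial>\<mu>)"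
    by simp
  finally show ?thesis
    using \<psi>(2) False by simp
qed

end

section \<open>Fourier coefficients of trigonometric polynomials\<close>

lemma bounded_linear_scaleC: "bounded_linear (\<lambda>c. c *\<^sub>C y)" for y :: "'y::complex_hilbert_space"
  by (rule bounded_linear_intro[of _ "norm y"])
    (simp_all add: scaleC_add_left scaleR_scaleC scaleC_scaleC scaleC_complex_def norm_scaleC)

lemma scaleC_zero_left [simp]: "0 *\<^sub>C y = 0"
  and scaleC_zero_right [simp]: "c *\<^sub>C 0 = 0" for y :: "'y::complex_hilbert_space"
  using norm_scaleC[of 0 y] norm_scaleC[of c 0] by simp_all

lemma fourier_coeff_two_terms:
  fixes \<Phi> :: "('g::ab_group_add \<Rightarrow> complex) \<Rightarrow> ('i \<Rightarrow> 'x) \<Rightarrow> 'j \<Rightarrow> 'y::fin_dim_complex_hilbert_space"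
  assumes haar: "haar_probability \<mu>"
    and \<Phi>: "\<And>\<xi>. \<xi> \<in> dual_group \<Longrightarrow> \<Phi> \<xi> u j = a + \<xi> \<gamma> *\<^sub>C b"
  shows "fourier_coeff \<mu> \<Phi> \<delta> u j = (if \<delta> = 0 then a else 0) + (if \<delta> = \<gamma> then b else 0)"
proof -
  note integrable =
    integrable_bounded_linear[OF bounded_linear_scaleC integrable_haar_coordinate[OF haar]]
  have "cnj (\<xi> \<delta>) *\<^sub>C \<Phi> \<xi> u j = \<xi> (- \<delta>) *\<^sub>C a + \<xi> (\<gamma> - \<delta>) *\<^sub>C b" if "\<xi> \<in> dual_group" for \<xi>
    using dual_group_add[OF that, of "- \<delta>" \<gamma>]
    by (simp add: \<Phi>[OF that] dual_group_minus[OF that] scaleC_add_right scaleC_scaleC)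
  then have "fourier_coeff \<mu> \<Phi> \<delta> u j = (\<integral>\<xi>. \<xi> (- \<delta>) *\<^sub>C a + \<xi> (\<gamma> - \<delta>) *\<^sub>C b \<partial>\<mu>)"
    unfolding fourier_coeff_def
    by (intro Bochner_Integration.integral_cong) (simp_all add: space_haar[OF haar])
  also have "\<dots> = (\<integral>\<xi>. \<xi> (- \<delta>) \<partial>\<mu>) *\<^sub>C a + (\<integral>\<xi>. \<xi> (\<gamma> - \<delta>) \<partial>\<mu>) *\<^sub>C b"
    by (simp only: Bochner_Integration.integral_add[OF integrable integrable]
        integral_bounded_linear[OF bounded_linear_scaleC integrable_haar_coordinate[OF haar]])
  finally show ?thesis
    by (simp add: integral_dual_coordinate[OF haar] scaleC_one)
qed

section \<open>Free actions and gain graphs\<close>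

context
  fixes V :: "'v set" and E :: "'v set set" and \<theta> :: "'g::ab_group_add \<Rightarrow> 'v \<Rightarrow> 'v"
  assumes action: "graph_action V E \<theta>"
begin

lemma action_in_V: "v \<in> V \<Longrightarrow> \<theta> \<gamma> v \<in> V"
  using action by (auto simp: graph_action_def graph_automorphism_def bij_betw_def)

lemma action_add: "v \<in> V \<Longrightarrow> \<theta> (\<gamma> + \<delta>) v = \<theta> \<gamma> (\<theta> \<delta> v)"
  using action by (simp add: graph_action_def)

lemma action_zero:
  assumes "v \<in> V"
  shows "\<theta> 0 v = v"
proof -
  have "inj_on (\<theta> 0) V"
    using action by (auto simp: graph_action_def graph_automorphism_def bij_betw_def)
  moreover have "\<theta> 0 (\<theta> 0 v) = \<theta> 0 v"
    using action_add[OF assms, of 0 0] by simp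
  ultimately show ?thesis
    using assms action_in_V[OF assms] by (metis inj_onD)
qed

lemma action_minus: "v \<in> V \<Longrightarrow> \<theta> (- \<gamma>) (\<theta> \<gamma> v) = v"
  using action_add[of v "- \<gamma>" \<gamma>] action_zero by simp

lemma vertex_orbit_subset: "O' \<in> vertex_orbits V \<theta> \<Longrightarrow> O' \<subseteq> V"
  by (auto simp: vertex_orbits_def action_in_V)

lemma vertex_orbit_eq_range:
  assumes "O' \<in> vertex_orbits V \<theta>" "v \<in> O'"
  shows "O' = range (\<lambda>\<gamma>. \<theta> \<gamma> v)"
proof -
  obtain w where w: "w \<in> V" "O' = range (\<lambda>\<gamma>. \<theta> \<gamma> w)"
    using assms(1) by (auto simp: vertex_orbits_def)
  obtain \<delta> where v: "v = \<theta> \<delta> w"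
    using assms(2) w(2) by blast
  have "\<theta> \<gamma> v = \<theta> (\<gamma> + \<delta>) w" "\<theta> \<gamma> w = \<theta> (\<gamma> - \<delta>) v" for \<gamma>
    using action_add[OF w(1), of \<gamma> \<delta>] action_add[OF w(1), of "\<gamma> - \<delta>" \<delta>] by (simp_all add: v)
  then show ?thesis
    unfolding w(2) by (metis (no_types, lifting) rangeI image_subsetI subset_antisym)
qed

lemma free_action_inj:
  assumes free: "free_action V E \<theta>" and v: "v \<in> V" and eq: "\<theta> \<gamma> v = \<theta> \<delta> v"
  shows "\<gamma> = \<delta>"
proof -
  have "\<theta> (- \<delta> + \<gamma>) v = v"
    using action_add[OF v, of "- \<delta>" \<gamma>] action_minus[OF v] eq by simp
  then have "- \<delta> + \<gamma> = 0"
    using free v unfolding free_action_def by blast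
  then show ?thesis
    by (simp add: add_eq_0_iff)
qed

lemma translated_vrep_eq_iff:
  assumes free: "free_action V E \<theta>" and gg: "gain_graph V E \<theta> Q"
    and v: "v \<in> vertex_orbits V \<theta>" and w: "w \<in> vertex_orbits V \<theta>"
  shows "\<theta> \<gamma> (vrep Q v) = \<theta> \<delta> (vrep Q w) \<longleftrightarrow> v = w \<and> \<gamma> = \<delta>"
proof
  assume eq: "\<theta> \<gamma> (vrep Q v) = \<theta> \<delta> (vrep Q w)"
  have rep: "vrep Q v \<in> v" "vrep Q w \<in> w"
    using gg v w by (simp_all add: gain_graph_def)
  then have inV: "vrep Q v \<in> V"
    using vertex_orbit_subset v by blast
  have "\<theta> \<gamma> (vrep Q v) \<in> v" "\<theta> \<gamma> (vrep Q v) \<in> w"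
    using vertex_orbit_eq_range[OF v rep(1)] vertex_orbit_eq_range[OF w rep(2)] eq
    by (metis rangeI)+
  then have "v = w"
    using vertex_orbit_eq_range v w by metis
  then show "v = w \<and> \<gamma> = \<delta>"
    using free_action_inj[OF free inV] eq by simp
qed simp

text \<open>A non-zero translate of a representative cannot be the source endpoint of a chosen edge,
  because that endpoint is itself a representative.\<close>

lemma translate_in_edge_rep_iff:
  assumes free: "free_action V E \<theta>" and gg: "gain_graph V E \<theta> Q"
    and v: "v \<in> vertex_orbits V \<theta>" and e: "e \<in> edge_orbits E \<theta>" and "\<gamma> \<noteq> 0"
  shows "\<theta> \<gamma> (vrep Q v) \<in> edge_rep \<theta> Q e \<longleftrightarrow> v = target Q e \<and> \<gamma> = gain Q e"
proof -
  have st: "source Q e \<in> vertex_orbits V \<theta>" "target Q e \<in> vertex_orbits V \<theta>"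
    using gg e by (simp_all add: gain_graph_def)
  then have "vrep Q (source Q e) = \<theta> 0 (vrep Q (source Q e))"
    using gg vertex_orbit_subset action_zero by (force simp: gain_graph_def)
  then have "\<theta> \<gamma> (vrep Q v) \<noteq> vrep Q (source Q e)"
    using translated_vrep_eq_iff[OF free gg v st(1), of \<gamma> 0] \<open>\<gamma> \<noteq> 0\<close> by metis
  then show ?thesis
    using translated_vrep_eq_iff[OF free gg v st(2)] by (simp add: edge_rep_def)
qed

end

section \<open>The symbol function\<close>

lemma coboundary_doubleton: "coboundary \<phi> {a, b} b = \<phi> b a"
proof -
  have "(THE w. {a, b} = {b, w}) = a"
    by (rule the_equality) (auto simp: doubleton_eq_iff)
  then show ?thesis
    by (simp add: coboundary_def)
qed

lemma clinear_zero: "clinear f \<Longrightarrow> f 0 = 0"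
  using module_hom.zero[OF Vector_Spaces.linear.axioms(3)] .

lemma symbol_row:
  assumes "finite (vertex_orbits V \<theta>)" and "gain_graph V E \<theta> Q" and e: "e \<in> edge_orbits E \<theta>"
  defines "s \<equiv> source Q e" and "t \<equiv> target Q e" and "\<gamma> \<equiv> gain Q e"
  shows "symbol V E \<phi> \<theta> Q \<xi> u e =
    \<phi> (vrep Q s) (\<theta> \<gamma> (vrep Q t)) (u s) + \<xi> \<gamma> *\<^sub>C \<phi> (vrep Q t) (\<theta> (- \<gamma>) (vrep Q s)) (u t)"
proof -
  let ?a = "\<phi> (vrep Q s) (\<theta> \<gamma> (vrep Q t)) (u s)"
  let ?b = "\<xi> \<gamma> *\<^sub>C \<phi> (vrep Q t) (\<theta> (- \<gamma>) (vrep Q s)) (u t)"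
  have st: "s \<in> vertex_orbits V \<theta>" "t \<in> vertex_orbits V \<theta>"
    using assms(2) e by (simp_all add: gain_graph_def s_def t_def)
  have "symbol_entry \<phi> \<theta> Q \<xi> e v (u v) = (if v = s then ?a else 0) + (if v = t then ?b else 0)" for v
    by (auto simp: symbol_entry_def Let_def s_def t_def \<gamma>_def)
  then show ?thesis
    using e assms(1) st by (simp add: symbol_def block_operator_def sum.distrib)
qed

lemma fourier_coeff_symbol:
  assumes "haar_probability \<mu>"
    and "finite (vertex_orbits V \<theta>)" and "gain_graph V E \<theta> Q" and "e \<in> edge_orbits E \<theta>"
  defines "s \<equiv> source Q e" and "t \<equiv> target Q e" and "\<gamma> \<equiv> gain Q e"
  shows "fourier_coeff \<mu> (symbol V E \<phi> \<theta> Q) \<delta> u e =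
    (if \<delta> = 0 then \<phi> (vrep Q s) (\<theta> \<gamma> (vrep Q t)) (u s) else 0) +
    (if \<delta> = \<gamma> then \<phi> (vrep Q t) (\<theta> (- \<gamma>) (vrep Q s)) (u t) else 0)"
  unfolding s_def t_def \<gamma>_def
  by (rule fourier_coeff_two_terms[OF assms(1)]) (rule symbol_row[OF assms(2-4)])

lemma symbol_fourier_expansion:
  assumes sym: "symmetric_framework V E \<phi> \<theta> \<tau>" and gg: "gain_graph V E \<theta> Q"
    and haar: "haar_probability \<mu>" and \<xi>: "\<xi> \<in> dual_group"
  shows "symbol V E \<phi> \<theta> Q \<xi> u e = fourier_coeff \<mu> (symbol V E \<phi> \<theta> Q) 0 u e +
    (\<Sum>\<gamma>\<in>nonzero_gains E \<theta> Q. \<xi> \<gamma> *\<^sub>C fourier_coeff \<mu> (symbol V E \<phi> \<theta> Q) \<gamma> u e)"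
proof (cases "e \<in> edge_orbits E \<theta>")
  case False
  then have "symbol V E \<phi> \<theta> Q \<psi> u e = 0" for \<psi>
    by (simp add: symbol_def block_operator_def)
  then show ?thesis
    by (simp add: fourier_coeff_def)
next
  case True
  let ?\<Gamma> = "nonzero_gains E \<theta> Q" and ?g = "gain Q e"
  have fin: "finite (vertex_orbits V \<theta>)"
    using sym by (simp add: symmetric_framework_def)
  define a where "a = \<phi> (vrep Q (source Q e)) (\<theta> ?g (vrep Q (target Q e))) (u (source Q e))"
  define b where "b = \<phi> (vrep Q (target Q e)) (\<theta> (- ?g) (vrep Q (source Q e))) (u (target Q e))"
  have row: "symbol V E \<phi> \<theta> Q \<xi> u e = a + \<xi> ?g *\<^sub>C b"
    using symbol_row[OF fin gg True] by (simp add: a_def b_def)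
  have coeff: "fourier_coeff \<mu> (symbol V E \<phi> \<theta> Q) \<delta> u e =
      (if \<delta> = 0 then a else 0) + (if \<delta> = ?g then b else 0)" for \<delta>
    unfolding a_def b_def by (rule fourier_coeff_symbol[OF haar fin gg True])
  have "(\<Sum>\<gamma>\<in>?\<Gamma>. \<xi> \<gamma> *\<^sub>C fourier_coeff \<mu> (symbol V E \<phi> \<theta> Q) \<gamma> u e) =
      (\<Sum>\<gamma>\<in>?\<Gamma>. if \<gamma> = ?g then \<xi> ?g *\<^sub>C b else 0)"
    by (rule sum.cong) (auto simp: coeff nonzero_gains_def)
  also have "\<dots> = (if ?g = 0 then 0 else \<xi> ?g *\<^sub>C b)"
    using finite_nonzero_gains[OF sym, of Q] True by (auto simp: nonzero_gains_def)
  finally show ?thesis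
    using dual_group_0[OF \<xi>] by (auto simp: row coeff scaleC_one)
qed

lemma fourier_coeff_symbol_entry:
  fixes \<phi> :: "'v \<Rightarrow> 'v \<Rightarrow> 'x::complex_hilbert_space \<Rightarrow> 'y::fin_dim_complex_hilbert_space"
    and \<theta> :: "'g::ab_group_add \<Rightarrow> 'v \<Rightarrow> 'v"
  assumes sym: "symmetric_framework V E \<phi> \<theta> \<tau>" and gg: "gain_graph V E \<theta> Q"
    and haar: "haar_probability \<mu>" and \<gamma>: "\<gamma> \<noteq> 0"
    and v: "v \<in> vertex_orbits V \<theta>" and e: "e \<in> edge_orbits E \<theta>"
  shows "operator_entry (fourier_coeff \<mu> (symbol V E \<phi> \<theta> Q) \<gamma>) e v =
    coboundary \<phi> (edge_rep \<theta> Q e) (\<theta> \<gamma> (vrep Q v)) \<circ> linear_part (\<tau> \<gamma>)"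
proof -
  let ?s' = "vrep Q (source Q e)" and ?t' = "vrep Q (target Q e)" and ?g = "gain Q e"
  have fin: "finite (vertex_orbits V \<theta>)" and action: "graph_action V E \<theta>"
    and free: "free_action V E \<theta>" and fw: "framework V E \<phi>"
    and equi: "\<And>\<gamma> v w. v \<in> V \<Longrightarrow> w \<in> V \<Longrightarrow>
      \<phi> (\<theta> \<gamma> v) (\<theta> \<gamma> w) = \<phi> v w \<circ> linear_part (\<tau> (- \<gamma>))"
    using sym unfolding symmetric_framework_def by blast+
  have "source Q e \<in> vertex_orbits V \<theta>" "target Q e \<in> vertex_orbits V \<theta>"
    and "?s' \<in> source Q e" "?t' \<in> target Q e"
    using gg e by (simp_all add: gain_graph_def)
  then have inV: "?s' \<in> V" "?t' \<in> V"
    using vertex_orbit_subset[OF action] by (metis subsetD)+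
  have "clinear (\<phi> ?t' (\<theta> (- ?g) ?s'))"
    using fw inV action_in_V[OF action] by (simp add: framework_def)
  note zero = clinear_zero[OF this]
  have entry: "operator_entry (fourier_coeff \<mu> (symbol V E \<phi> \<theta> Q) \<gamma>) e v =
      (if v = target Q e \<and> \<gamma> = ?g then \<phi> ?t' (\<theta> (- ?g) ?s') else (\<lambda>x. 0))"
    unfolding operator_entry_def fourier_coeff_symbol[OF haar fin gg e]
    using \<gamma> by (intro ext) (simp add: zero)
  show ?thesis
  proof (cases "v = target Q e \<and> \<gamma> = ?g")
    case False
    then have "\<theta> \<gamma> (vrep Q v) \<notin> edge_rep \<theta> Q e"
      using translate_in_edge_rep_iff[OF action free gg v e \<gamma>] by blast
    then show ?thesis
      using False unfolding entry by (auto simp: coboundary_def fun_eq_iff)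
  next
    case True
    have "\<phi> ?t' (\<theta> (- ?g) ?s') = \<phi> (\<theta> ?g ?t') ?s' \<circ> linear_part (\<tau> ?g)"
      using equi[OF action_in_V[OF action inV(2)] inV(1), of "- ?g" ?g]
      by (simp only: action_minus[OF action inV(2)] minus_minus)
    then show ?thesis
      using True unfolding entry by (simp add: edge_rep_def coboundary_doubleton)
  qed
qed

section \<open>Fourier expansion of the symbol function\<close>

theorem corollary3p10:
  fixes V :: "'v set" and E :: "'v set set"
    and \<phi> :: "'v \<Rightarrow> 'v \<Rightarrow> 'x::fin_dim_complex_hilbert_space \<Rightarrow> 'y::fin_dim_complex_hilbert_space"
    and \<theta> :: "'g::ab_group_add \<Rightarrow> 'v \<Rightarrow> 'v"
    and \<tau> :: "'g \<Rightarrow> 'x \<Rightarrow> 'x"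
    and Q :: "('v, 'g) gain_data"
    and \<mu> :: "('g \<Rightarrow> complex) measure"
  assumes "symmetric_framework V E \<phi> \<theta> \<tau>"
    and "gain_graph V E \<theta> Q"
    and "haar_probability \<mu>"
  shows "(\<forall>\<xi>\<in>dual_group. symbol V E \<phi> \<theta> Q \<xi> =
      (\<lambda>u e. fourier_coeff \<mu> (symbol V E \<phi> \<theta> Q) 0 u e +
        (\<Sum>\<gamma>\<in>nonzero_gains E \<theta> Q. \<xi> \<gamma> *\<^sub>C fourier_coeff \<mu> (symbol V E \<phi> \<theta> Q) \<gamma> u e))) \<and>
    (\<forall>\<gamma>\<in>nonzero_gains E \<theta> Q. \<forall>v\<in>vertex_orbits V \<theta>. \<forall>e\<in>edge_orbits E \<theta>.
      operator_entry (fourier_coeff \<mu> (symbol V E \<phi> \<theta> Q) \<gamma>) e v =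
        coboundary \<phi> (edge_rep \<theta> Q e) (\<theta> \<gamma> (vrep Q v)) \<circ> linear_part (\<tau> \<gamma>))"
proof (intro conjI ballI)
  fix \<xi> :: "'g \<Rightarrow> complex" assume "\<xi> \<in> dual_group"
  then show "symbol V E \<phi> \<theta> Q \<xi> =
      (\<lambda>u e. fourier_coeff \<mu> (symbol V E \<phi> \<theta> Q) 0 u e +
        (\<Sum>\<gamma>\<in>nonzero_gains E \<theta> Q. \<xi> \<gamma> *\<^sub>C fourier_coeff \<mu> (symbol V E \<phi> \<theta> Q) \<gamma> u e))"
    by (intro ext symbol_fourier_expansion[OF assms])
next
  fix \<gamma> v e
  assume "\<gamma> \<in> nonzero_gains E \<theta> Q" "v \<in> vertex_orbits V \<theta>" "e \<in> edge_orbits E \<theta>"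
  then show "operator_entry (fourier_coeff \<mu> (symbol V E \<phi> \<theta> Q) \<gamma>) e v =
      coboundary \<phi> (edge_rep \<theta> Q e) (\<theta> \<gamma> (vrep Q v)) \<circ> linear_part (\<tau> \<gamma>)"
    by (intro fourier_coeff_symbol_entry[OF assms]) (simp_all add: nonzero_gains_def)
qed

end
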